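(* Let $3\le m\le n$ and let $c$ be an exact $(m+n+1)$-coloring of $[m]\times[n]$ with no rainbow solution to $x_1+x_2=x_3$. Suppose there is a jump from $\alpha\in D_a$ to $\beta\in D_b$, so that $\alpha+\delta=\beta$ for some $\delta=(d_1,d_2)\in D_t$. Then $c(\alpha)\in c(D_m)$ or $c(\beta)\in c(D_m)$ or $c(\alpha)=c(\beta)$.
   Context: $[m]\times[n]=\{(i,j)\in\mathbb{Z}^2:1\le i\le m,1\le j\le n\}$ with componentwise addition. An $r$-coloring is a map $c:[m]\times[n]\to\{1,\dots,r\}$, exact if surjective; a rainbow solution is a triple $\alpha,\beta,\gamma$ with $\alpha+\beta=\gamma$ and pairwise distinct colors. Diagonals: $D_k=\{(i,j)\in[m]\times[n]: m-k=i-j\}$; $D_m$ is the main diagonal; $c(X)=\{c(x):x\in X\}$. For $\alpha=(a_1,a_2)\in D_a$ and $\beta=(b_1,b_2)\in D_b$ with $a\ne b$, there is a jump from $\alpha$ to $\beta$ if $a_1<b_1$ and $a_2<b_2$ (equivalently $\alpha+\delta=\beta$ for some $\delta\in[m]\times[n]$). *)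

theory Defs
  imports Main "HOL-Library.Product_Plus" "HOL-Library.FuncSet"
begin

text \<open>
  Points live in \<open>int \<times> int\<close>, whose componentwise addition comes from
  \<open>HOL-Library.Product_Plus\<close>.
\<close>

definition grid :: "nat \<Rightarrow> nat \<Rightarrow> (int \<times> int) set" where
  "grid m n = {1..int m} \<times> {1..int n}"

text \<open>
  Colorings are total functions on \<open>int \<times> int\<close>; only their values on the grid are
  ever constrained or used.
\<close>

definition coloring :: "nat \<Rightarrow> nat \<Rightarrow> nat \<Rightarrow> (int \<times> int \<Rightarrow> nat) \<Rightarrow> bool" where
  "coloring m n r c \<longleftrightarrow> c \<in> grid m n \<rightarrow> {1..r}"

definition exact_coloring :: "nat \<Rightarrow> nat \<Rightarrow> nat \<Rightarrow> (int \<times> int \<Rightarrow> nat) \<Rightarrow> bool" where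
  "exact_coloring m n r c \<longleftrightarrow> coloring m n r c \<and> c ` grid m n = {1..r}"

definition rainbow_solution ::
    "nat \<Rightarrow> nat \<Rightarrow> (int \<times> int \<Rightarrow> nat) \<Rightarrow> int \<times> int \<Rightarrow> int \<times> int \<Rightarrow> int \<times> int \<Rightarrow> bool" where
  "rainbow_solution m n c \<alpha> \<beta> \<gamma> \<longleftrightarrow>
     \<alpha> \<in> grid m n \<and> \<beta> \<in> grid m n \<and> \<gamma> \<in> grid m n \<and> \<alpha> + \<beta> = \<gamma> \<and>
     c \<alpha> \<noteq> c \<beta> \<and> c \<alpha> \<noteq> c \<gamma> \<and> c \<beta> \<noteq> c \<gamma>"

text \<open>The index is an integer, so that \<open>m - k\<close> is not truncated; the diagonal is
  nonempty exactly for \<open>1 \<le> k \<le> m + n - 1\<close> (if \<open>m, n \<ge> 1\<close>).\<close>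

definition diagonal :: "nat \<Rightarrow> nat \<Rightarrow> int \<Rightarrow> (int \<times> int) set" where
  "diagonal m n k = {(i, j) \<in> grid m n. int m - k = i - j}"

text \<open>A jump from \<open>\<alpha> \<in> D\<^sub>a\<close> to \<open>\<beta> \<in> D\<^sub>b\<close>; distinctness of the two diagonals is
  part of the notion.\<close>

definition jump ::
    "nat \<Rightarrow> nat \<Rightarrow> int \<Rightarrow> int \<times> int \<Rightarrow> int \<Rightarrow> int \<times> int \<Rightarrow> bool" where
  "jump m n a \<alpha> b \<beta> \<longleftrightarrow>
     \<alpha> \<in> diagonal m n a \<and> \<beta> \<in> diagonal m n b \<and> a \<noteq> b \<and>
     fst \<alpha> < fst \<beta> \<and> snd \<alpha> < snd \<beta>"

end

theory Submission
  imports Defs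
begin

text \<open>
  On the main diagonal a rainbow-free coloring uses \<open>d\<close> colors with \<open>2 ^ (d - 1) \<le> m\<close>, and every
  other diagonal carries at most one color that is new, i.e. not used on the main diagonal, since two
  of its points differ by a point of the main diagonal. There are \<open>m + n + 1 - d\<close> new colors on
  \<open>m + n - 2\<close> diagonals, so if one point is chosen for each new color, only \<open>D = d - 3\<close> diagonals
  other than the main one contain no chosen point, and \<open>4 * 2 ^ D \<le> m\<close>. Whenever the sum or the
  difference of two chosen points lies in the grid, it has one of their two colors, so it lies on
  one of these \<open>D\<close> gap diagonals (or the larger point has twice the offset of the smaller one).

  If there is a jump from \<open>\<alpha>\<close> to \<open>\<beta> = \<alpha> + \<delta>\<close> between points of distinct new colors, then each
  diagonal passing close to \<open>\<alpha>\<close> and \<open>\<beta>\<close> is a gap or creates one, which bounds \<open>\<delta>\<close> linearly in \<open>D\<close>.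
  As \<open>\<delta>\<close> shares the color of \<open>\<alpha>\<close> or \<open>\<beta>\<close>, it may be chosen instead of that point. But for such a
  small chosen point every diagonal of moderate offset is a gap or creates one, which bounds the grid
  size linearly in \<open>D\<close>. Together with \<open>4 * 2 ^ D \<le> m \<le> n\<close> this is contradictory; only \<open>D \<le> 1\<close>
  needs a closer look.
\<close>

section \<open>Colors of a rainbow-free coloring of an interval\<close>

text \<open>If the color of \<open>m\<close> occurs only at \<open>m\<close>, then \<open>x\<close>
  and \<open>m - x\<close> share a color, so the lower half already shows all other colors: halving
  the interval costs one color.\<close>

lemma card_colors_rainbow_free_interval:
  fixes f :: "nat \<Rightarrow> 'a"
  assumes "1 \<le> m"
    and "\<And>x y. 1 \<le> x \<Longrightarrow> 1 \<le> y \<Longrightarrow> x + y \<le> m \<Longrightarrow> f x = f y \<or> f x = f (x + y) \<or> f y = f (x + y)"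
  shows "2 ^ (card (f ` {1..m}) - 1) \<le> m"
  using assms
proof (induction m rule: less_induct)
  case (less m)
  show ?case
  proof (cases "m = 1")
    case True
    then show ?thesis by simp
  next
    case False
    with less.prems(1) have m2: "2 \<le> m" by simp
    have split: "{1..m} = insert m {1..m-1}" using m2 by auto
    show ?thesis
    proof (cases "f m \<in> f ` {1..m-1}")
      case True
      then have "f ` {1..m} = f ` {1..m-1}" using split by auto
      moreover have "2 ^ (card (f ` {1..m-1}) - 1) \<le> m - 1"
        by (rule less.IH) (use m2 less.prems(2) in auto)
      ultimately show ?thesis by simp
    next
      case False
      have sym: "f x = f (m - x)" if "1 \<le> x" "x < m" for x
      proof -
        have "x \<in> {1..m-1}" "m - x \<in> {1..m-1}" using that by auto
        then have "f x \<noteq> f m" "f (m - x) \<noteq> f m" using False by (metis imageI)+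
        then show ?thesis using less.prems(2)[of x "m - x"] that by auto
      qed
      have "f ` {1..m-1} = f ` {1..m div 2}"
      proof (intro equalityI subsetI)
        fix y assume "y \<in> f ` {1..m-1}"
        then obtain x where x: "1 \<le> x" "x < m" "y = f x" using m2 by force
        show "y \<in> f ` {1..m div 2}"
        proof (cases "x \<le> m div 2")
          case True
          then show ?thesis using x by auto
        next
          case False
          then have "m - x \<in> {1..m div 2}" using x by auto
          then show ?thesis using x sym[of x] by auto
        qed
      qed (use m2 in auto)
      moreover have "2 ^ (card (f ` {1..m div 2}) - 1) \<le> m div 2"
        by (rule less.IH) (use m2 less.prems(2) in auto)
      moreover have "card (f ` {1..m div 2}) > 0" using m2 by (simp add: card_gt_0_iff)
      moreover have "card (f ` {1..m}) = Suc (card (f ` {1..m-1}))"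
        using False split by simp
      ultimately have "2 ^ (card (f ` {1..m}) - 1) = 2 * (2 ^ (card (f ` {1..m div 2}) - 1) :: nat)"
        by (cases "card (f ` {1..m div 2})") auto
      also have "\<dots> \<le> m" using \<open>2 ^ (card (f ` {1..m div 2}) - 1) \<le> m div 2\<close> by linarith
      finally show ?thesis .
    qed
  qed
qed

section \<open>Counting offsets around a jump and around a small point\<close>

text \<open>
  \<open>P\<close> is the set of chosen points and \<open>E\<close> the set of nonzero offsets \<open>x - y\<close> of the gap diagonals.
\<close>

locale sparse_transversal =
  fixes m n :: int and P :: "(int \<times> int) set" and E :: "int set"
  assumes in_grid: "(x, y) \<in> P \<Longrightarrow> 1 \<le> x \<and> x \<le> m \<and> 1 \<le> y \<and> y \<le> n \<and> x \<noteq> y"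
    and finite_gaps: "finite E"
    and cover: "1 - n \<le> z \<Longrightarrow> z \<le> m - 1 \<Longrightarrow> z \<noteq> 0 \<Longrightarrow> z \<in> E \<or> (\<exists>x y. (x, y) \<in> P \<and> x - y = z)"
    and sum_gap: "(x, y) \<in> P \<Longrightarrow> (x', y') \<in> P \<Longrightarrow> (x, y) \<noteq> (x', y') \<Longrightarrow> x + x' \<le> m \<Longrightarrow> y + y' \<le> n
      \<Longrightarrow> (x - y) + (x' - y') \<in> E"
    and diff_gap: "(x, y) \<in> P \<Longrightarrow> (x', y') \<in> P \<Longrightarrow> x < x' \<Longrightarrow> y < y'
      \<Longrightarrow> (x' - y') - (x - y) \<in> E \<or> x' - y' = 2 * (x - y)"
begin

text \<open>A point with offset in this open range exceeds \<open>(a1, a2)\<close> in both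
  coordinates or is exceeded in both by the other end of the jump, so \<open>diff_gap\<close>
  applies to one of these pairs.\<close>

lemma offset_near_jump:
  assumes "(a1, a2) \<in> P" "(a1 + d1, a2 + d2) \<in> P" and d: "1 \<le> d1" "1 \<le> d2"
    and u: "u = a1 - a2" and w: "w = u + d1 - d2"
    and z: "u - d2 < z" "z < u + d1"
  shows "z \<in> {0, u, w, 2 * u} \<or> 2 * z = w \<or> z \<in> E \<or> z - u \<in> E \<or> w - z \<in> E"
proof (rule ccontr)
  assume "\<not> ?thesis"
  then have ne: "z \<noteq> 0" "z \<noteq> u" "z \<noteq> w" "z \<noteq> 2 * u" "2 * z \<noteq> w" "z \<notin> E" "z - u \<notin> E" "w - z \<notin> E"
    by auto
  have "1 - n \<le> z" "z \<le> m - 1"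
    using in_grid[OF assms(1)] in_grid[OF assms(2)] u z by linarith+
  then obtain i j where ij: "(i, j) \<in> P" "i - j = z"
    using cover ne by blast
  have "\<not> (a1 < i \<and> a2 < j)"
    using diff_gap[OF assms(1) ij(1)] ij ne u by auto
  moreover have "\<not> (i < a1 + d1 \<and> j < a2 + d2)"
    using diff_gap[OF ij(1) assms(2)] ij ne u w by (auto simp: algebra_simps)
  ultimately show False using u z ij(2) d by linarith
qed

lemma gap_of_jump:
  assumes "(a1, a2) \<in> P" "(a1 + d1, a2 + d2) \<in> P" "1 \<le> d1" "1 \<le> d2"
  shows "d1 - d2 \<in> E \<or> d1 - d2 = a1 - a2"
proof -
  have "(a1 + d1 - (a2 + d2)) - (a1 - a2) = d1 - d2" by simp
  then show ?thesis
    using diff_gap[OF assms(1,2)] assms(3,4) by auto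
qed

text \<open>The \<open>d1 + d2 - 1\<close> offsets near the jump lie in three copies of
  \<open>E\<close>, up to five exceptions; \<open>gap_of_jump\<close> saves two of these elements.
  The second bound saves one more, as \<open>0\<close> and \<open>2 * u\<close> cannot both be
  near.\<close>

lemma jump_size_le:
  assumes P: "(a1, a2) \<in> P" "(a1 + d1, a2 + d2) \<in> P" and d: "1 \<le> d1" "1 \<le> d2"
  shows "d1 + d2 \<le> 3 * int (card E) + 4"
    and "d1 = 1 \<or> d2 = 1 \<Longrightarrow> d1 \<noteq> d2 \<Longrightarrow> d1 + d2 \<le> 3 * int (card E) + 3"
proof -
  define u where "u = a1 - a2"
  define w where "w = u + d1 - d2"
  let ?I = "{u - d2 + 1..u + d1 - 1}" and ?v = "d1 - d2"
  have cardI: "int (card ?I) = d1 + d2 - 1" using d by simp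
  have near: "z \<in> {0, u, w, 2 * u} \<or> 2 * z = w \<or> z \<in> E \<or> z - u \<in> E \<or> w - z \<in> E" if "z \<in> ?I" for z
    by (rule offset_near_jump[OF P d u_def w_def]) (use that in auto)
  have v: "?v \<in> E \<or> ?v = u"
    using gap_of_jump[OF P d] unfolding u_def .
  \<comment> \<open>\<open>Z\<close> holds those of the exceptions \<open>0\<close> and
    \<open>2 * u\<close> that must be counted. It has to contain \<open>2 * u\<close> if this equals
    \<open>w\<close>, so that the coincidence can be discounted.\<close>
  have bound: "card ?I \<le> 3 * card E + 1 + card Z"
    if Z: "Z \<subseteq> {0, 2 * u}" "?I \<inter> {0, 2 * u} \<subseteq> Z" "w = 2 * u \<Longrightarrow> 2 * u \<in> Z" for Z
  proof (cases "?v = u")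
    case True
    then have w2: "w = 2 * u" unfolding w_def by simp
    have finZ: "finite Z" using Z(1) finite_subset by blast
    \<comment> \<open>Here \<open>2 * u\<close> coincides with \<open>w\<close>, and the solution of
      \<open>2 * z = w\<close> with \<open>u\<close>.\<close>
    have "?I \<subseteq> E \<union> (\<lambda>e. u + e) ` E \<union> (\<lambda>e. w - e) ` E \<union> {u, w} \<union> (Z - {w})" (is "_ \<subseteq> ?A \<union> ?B \<union> ?C \<union> ?F \<union> ?G")
    proof
      fix z assume z: "z \<in> ?I"
      have "z - u \<in> E \<Longrightarrow> z \<in> ?B" "w - z \<in> E \<Longrightarrow> z \<in> ?C" by (force simp: image_iff)+
      then show "z \<in> ?A \<union> ?B \<union> ?C \<union> ?F \<union> ?G"
        using near[OF z] Z(2) z w2 by auto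
    qed
    then have "card ?I \<le> card (?A \<union> ?B \<union> ?C \<union> ?F \<union> ?G)"
      by (rule card_mono[rotated]) (use finite_gaps finZ in auto)
    also have "\<dots> \<le> card ?A + card ?B + card ?C + card ?F + card ?G"
      by (meson add_le_mono card_Un_le le_refl order_trans)
    also have "\<dots> \<le> card E + card E + card E + 2 + (card Z - 1)"
    proof (intro add_le_mono)
      show "card ?F \<le> 2" by (simp add: card_insert_if)
    qed (use finite_gaps finZ Z(3) w2 in \<open>auto intro: card_image_le\<close>)
    also have "\<dots> \<le> 3 * card E + 1 + card Z"
      using Z(3)[OF w2] finZ card_gt_0_iff[of Z] by auto
    finally show ?thesis .
  next
    case False
    then have vE: "?v \<in> E" using v by simp
    have finZ: "finite Z" using Z(1) finite_subset by blast
    \<comment> \<open>The gap \<open>?v\<close> contributes only \<open>w\<close> to the second copy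
      and \<open>u\<close> to the third; both are listed anyway.\<close>
    let ?E = "E - {?v}"
    have "?I \<subseteq> E \<union> (\<lambda>e. u + e) ` ?E \<union> (\<lambda>e. w - e) ` ?E \<union> {u, w, w div 2} \<union> Z" (is "_ \<subseteq> ?A \<union> ?B \<union> ?C \<union> ?F \<union> ?G")
    proof
      fix z assume z: "z \<in> ?I"
      have Zz: "z = 0 \<Longrightarrow> z \<in> Z" "z = 2 * u \<Longrightarrow> z \<in> Z" using Z(2) z by blast+
      have "z - u \<in> E \<Longrightarrow> z \<in> insert w ?B" "w - z \<in> E \<Longrightarrow> z \<in> insert u ?C" 
        by (force simp: image_iff w_def)+
      then show "z \<in> ?A \<union> ?B \<union> ?C \<union> ?F \<union> ?G"
        using near[OF z] Zz by auto
    qed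
    then have "card ?I \<le> card (?A \<union> ?B \<union> ?C \<union> ?F \<union> ?G)"
      by (rule card_mono[rotated]) (use finite_gaps finZ in auto)
    also have "\<dots> \<le> card ?A + card ?B + card ?C + card ?F + card ?G"
      by (meson add_le_mono card_Un_le le_refl order_trans)
    also have "\<dots> \<le> card E + card ?E + card ?E + 3 + card Z"
    proof (intro add_le_mono)
      show "card ?F \<le> 3" by (simp add: card_insert_if)
    qed (use finite_gaps in \<open>auto intro: card_image_le\<close>)
    also have "card ?E = card E - 1" using vE finite_gaps by simp
    also have "card E + (card E - 1) + (card E - 1) + 3 + card Z = 3 * card E + 1 + card Z"
      using vE finite_gaps card_gt_0_iff[of E] by auto
    finally show ?thesis .
  qed
  have "card {0, 2 * u} \<le> 2" by (simp add: card_insert_if)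
  then show "d1 + d2 \<le> 3 * int (card E) + 4" using bound[of "{0, 2 * u}"] cardI by simp
  show "d1 + d2 \<le> 3 * int (card E) + 3" if d': "d1 = 1 \<or> d2 = 1" "d1 \<noteq> d2"
  proof (cases "0 \<in> ?I")
    case True
    \<comment> \<open>The range starts or ends at \<open>u\<close>, which lies strictly between
      \<open>0\<close> and \<open>2 * u\<close>. Moreover \<open>d1 - d2\<close> and
      \<open>u\<close> have opposite signs.\<close>
    then have "2 * u \<notin> ?I" "w \<noteq> 2 * u"
      using d d' in_grid[OF P(1)] in_grid[OF P(2)] unfolding u_def w_def by auto
    then show ?thesis using bound[of "{0}"] cardI by fastforce
  next
    case False
    then show ?thesis using bound[of "{2 * u}"] cardI by fastforce
  qed
qed

text \<open>A point with offset in this range exceeds \<open>(d1, d2)\<close> in both coordinates or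
  has its sum with \<open>(d1, d2)\<close> in the grid; \<open>small\<close> prevents both from
  failing in the same coordinate.\<close>

lemma offset_near_small_point:
  assumes P: "(d1, d2) \<in> P" and small: "2 * d1 \<le> m" "2 * d2 \<le> n"
    and z: "d1 + d2 - n \<le> z" "z \<le> m - d1 - d2"
  shows "z \<in> {0, d1 - d2, 2 * (d1 - d2)} \<or> z \<in> E \<or> z + (d1 - d2) \<in> E \<or> z - (d1 - d2) \<in> E"
proof (rule ccontr)
  assume "\<not> ?thesis"
  then have ne: "z \<noteq> 0" "z \<noteq> d1 - d2" "z \<noteq> 2 * (d1 - d2)" "z \<notin> E" "z + (d1 - d2) \<notin> E" "z - (d1 - d2) \<notin> E"
    by auto
  have "1 - n \<le> z" "z \<le> m - 1"
    using in_grid[OF P] z by linarith+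
  then obtain i j where ij: "(i, j) \<in> P" "i - j = z"
    using cover ne by blast
  have "\<not> (d1 < i \<and> d2 < j)"
    using diff_gap[OF P ij(1)] ij ne by auto
  moreover have "\<not> (i + d1 \<le> m \<and> j + d2 \<le> n)"
    using sum_gap[OF ij(1) P] ij ne by auto
  ultimately show False using z ij(2) small by linarith
qed

text \<open>A common lower bound \<open>K\<close> for the two sides makes the range of offsets
  symmetric; three copies of \<open>E\<close> and three exceptions cover it.\<close>

lemma small_point_bound:
  assumes P: "(d1, d2) \<in> P" and small: "2 * d1 \<le> m" "2 * d2 \<le> n"
    and K: "K \<le> m" "K \<le> n"
  shows "2 * (K - d1 - d2) + 1 \<le> 3 * int (card E) + 3"
proof -
  let ?I = "{d1 + d2 - K..K - d1 - d2}" and ?v = "d1 - d2"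
  let ?F = "{0, ?v, 2 * ?v}"
  have "?I \<subseteq> E \<union> (\<lambda>e. e - ?v) ` E \<union> (\<lambda>e. e + ?v) ` E \<union> ?F" (is "_ \<subseteq> ?A \<union> ?B \<union> ?C \<union> ?F")
  proof
    fix z assume "z \<in> ?I"
    then have "z \<in> {0, d1 - d2, 2 * (d1 - d2)} \<or> z \<in> E \<or> z + (d1 - d2) \<in> E \<or> z - (d1 - d2) \<in> E"
      using offset_near_small_point[OF P small, of z] K by auto
    moreover have "z + ?v \<in> E \<Longrightarrow> z \<in> ?B" "z - ?v \<in> E \<Longrightarrow> z \<in> ?C" by (force simp: image_iff)+
    ultimately show "z \<in> ?A \<union> ?B \<union> ?C \<union> ?F" by blast
  qed
  then have "card ?I \<le> card (?A \<union> ?B \<union> ?C \<union> ?F)"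
    by (rule card_mono[rotated]) (use finite_gaps in auto)
  also have "\<dots> \<le> card ?A + card ?B + card ?C + card ?F"
    by (meson add_le_mono card_Un_le le_refl order_trans)
  also have "\<dots> \<le> card E + card E + card E + 3"
  proof (intro add_le_mono)
    show "card ?F \<le> 3" by (simp add: card_insert_if)
  qed (use finite_gaps in \<open>auto intro: card_image_le\<close>)
  finally show ?thesis by simp
qed

end

section \<open>Excluding jumps when the grid is exponentially large in the number of gaps\<close>

lemma two_power_ge:
  "2 \<le> D \<Longrightarrow> 4 * int D - 4 \<le> 2 ^ D"
proof (induction D rule: dec_induct)
  case (step k)
  then show ?case by simp
qed simp

text \<open>
  For \<open>D = 1\<close> the diagonal constraints alone leave one configuration, up to transposition; it is
  excluded afterwards by inspecting the chosen points of offset 4 and 1.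
\<close>

lemma single_gap_configuration:
  fixes d1 d2 u w g g' :: int
  assumes d: "d1 = 4 \<and> d2 = 2 \<or> d1 = 4 \<and> d2 = 3 \<or> d1 = 5 \<and> d2 = 1 \<or> d1 = 5 \<and> d2 = 2"
    and I: "\<And>z. u - d2 < z \<Longrightarrow> z < u + d1 \<Longrightarrow> z \<in> {0, u, w, 2 * u, g} \<or> z - u = g \<or> w - z = g \<or> 2 * z = w"
    and J: "\<And>z. d1 \<le> 4 \<Longrightarrow> \<bar>z\<bar> \<le> 8 - d1 - d2 \<Longrightarrow>
      z \<in> {0, d1 - d2, 2 * (d1 - d2), g'} \<or> z + (d1 - d2) = g' \<or> z - (d1 - d2) = g'"
    and ex: "d1 - d2 = u \<and> g' = g \<or> d1 - d2 \<noteq> u \<and> d1 - d2 = g \<and> (g' = u \<or> g' = w)"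
    and w: "w = u + d1 - d2" and u0: "u \<noteq> 0" "w \<noteq> 0"
  shows "d1 = 5 \<and> d2 = 2 \<and> u = -1 \<and> w = 2 \<and> g = 3"
  using d ex
\<comment> \<open>Each case names offsets at which \<open>I\<close> or \<open>J\<close> fails; only
  \<open>(5, 2)\<close> with \<open>g = 3\<close> survives, where \<open>u + 1\<close> and
  \<open>u + 4\<close> force \<open>u = -1\<close>.\<close>
proof (elim disjE conjE)
  assume a: "d1 = 4" "d2 = 2" "d1 - d2 = u" "g' = g"
  then have b: "u = 2" "w = 4" using w by auto
  show ?thesis using I[of 1] J[of "-2"] a(1,2) b a(4) by auto
next
  assume a: "d1 = 4" "d2 = 2" "d1 - d2 \<noteq> u" "d1 - d2 = g" "g' = u"
  then have b: "u \<noteq> 2" "w = u + 2" "g = 2" using w by auto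
  show ?thesis using I[of "u + 1"] I[of "u + 3"] J[of "-2"] u0 a(1,2) b a(5) by auto
next
  assume a: "d1 = 4" "d2 = 2" "d1 - d2 \<noteq> u" "d1 - d2 = g" "g' = w"
  then have b: "u \<noteq> 2" "w = u + 2" "g = 2" using w by auto
  show ?thesis using I[of "u + 1"] I[of "u + 3"] J[of "-2"] u0 a(1,2) b a(5) by auto
next
  assume a: "d1 = 4" "d2 = 3" "d1 - d2 = u" "g' = g"
  then have b: "u = 1" "w = 2" using w by auto
  show ?thesis using I[of 3] I[of 4] J[of "-1"] a(1,2) b a(4) by auto
next
  assume a: "d1 = 4" "d2 = 3" "d1 - d2 \<noteq> u" "d1 - d2 = g" "g' = u"
  then have b: "u \<noteq> 1" "w = u + 1" "g = 1" using w by auto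
  show ?thesis using I[of "u - 1"] I[of "u + 2"] I[of "u + 3"] u0 a(1,2) b a(5) by auto
next
  assume a: "d1 = 4" "d2 = 3" "d1 - d2 \<noteq> u" "d1 - d2 = g" "g' = w"
  then have b: "u \<noteq> 1" "w = u + 1" "g = 1" using w by auto
  show ?thesis using I[of "u - 1"] I[of "u + 2"] I[of "u + 3"] u0 a(1,2) b a(5) by auto
next
  assume a: "d1 = 5" "d2 = 1" "d1 - d2 = u" "g' = g"
  then have b: "u = 4" "w = 8" using w by auto
  show ?thesis using I[of 5] I[of 6] a(1,2) b a(4) by auto
next
  assume a: "d1 = 5" "d2 = 1" "d1 - d2 \<noteq> u" "d1 - d2 = g" "g' = u"
  then have b: "u \<noteq> 4" "w = u + 4" "g = 4" using w by auto
  show ?thesis using I[of "u + 1"] I[of "u + 2"] I[of "u + 3"] u0 a(1,2) b a(5) by auto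
next
  assume a: "d1 = 5" "d2 = 1" "d1 - d2 \<noteq> u" "d1 - d2 = g" "g' = w"
  then have b: "u \<noteq> 4" "w = u + 4" "g = 4" using w by auto
  show ?thesis using I[of "u + 1"] I[of "u + 2"] I[of "u + 3"] u0 a(1,2) b a(5) by auto
next
  assume a: "d1 = 5" "d2 = 2" "d1 - d2 = u" "g' = g"
  then have b: "u = 3" "w = 6" using w by auto
  show ?thesis using I[of 5] I[of 7] a(1,2) b a(4) by auto
next
  assume a: "d1 = 5" "d2 = 2" "d1 - d2 \<noteq> u" "d1 - d2 = g" "g' = u"
  then have b: "u \<noteq> 3" "w = u + 3" "g = 3" using w by auto
  show ?thesis using I[of "u + 1"] I[of "u + 4"] u0 a(1,2) b a(5) by auto
next
  assume a: "d1 = 5" "d2 = 2" "d1 - d2 \<noteq> u" "d1 - d2 = g" "g' = w"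
  then have b: "u \<noteq> 3" "w = u + 3" "g = 3" using w by auto
  show ?thesis using I[of "u + 1"] I[of "u + 4"] u0 a(1,2) b a(5) by auto
qed

text \<open>In the application \<open>P'\<close> is \<open>P\<close> with one end of the jump
  replaced by \<open>(d1, d2)\<close>. The jump in \<open>P\<close> makes this point small; as a
  chosen point of \<open>P'\<close> it then bounds the grid, against \<open>K\<close>.\<close>

lemma sparse_transversal_no_jump_aux:
  assumes sp: "sparse_transversal m n P E" and sp': "sparse_transversal m n P' E'"
    and P: "(a1, a2) \<in> P" "(a1 + d1, a2 + d2) \<in> P" and d: "1 \<le> d1" "1 \<le> d2"
    and P': "(d1, d2) \<in> P'"
    and K: "4 * 2 ^ card E \<le> m" "4 * 2 ^ card E \<le> n"
    and cardE': "card E' = card E"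
    and exchange: "d1 - d2 = a1 - a2 \<and> E' = E \<or>
      d1 - d2 \<noteq> a1 - a2 \<and> d1 - d2 \<in> E \<and> (E' = insert (a1 - a2) (E - {d1 - d2}) \<or>
        E' = insert (a1 - a2 + d1 - d2) (E - {d1 - d2}))"
    and rest: "P - {(a1, a2), (a1 + d1, a2 + d2)} \<subseteq> P'"
    and lt: "d2 < d1"
  shows False
proof -
  interpret A: sparse_transversal m n P E by fact
  interpret B: sparse_transversal m n P' E' by fact
  define u where "u = a1 - a2"
  define w where "w = u + d1 - d2"
  have neq: "d1 \<noteq> d2" using B.in_grid[OF P'] by simp
  have u0: "u \<noteq> 0" "w \<noteq> 0" using A.in_grid[OF P(1)] A.in_grid[OF P(2)] unfolding w_def u_def by auto
  note size = A.jump_size_le[OF P d]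
  note near = A.offset_near_jump[OF P d u_def w_def]
  note small = B.offset_near_small_point[OF P']
  have count: "2 * (K - d1 - d2) + 1 \<le> 3 * int (card E) + 3"
    if "2 * d1 \<le> m" "2 * d2 \<le> n" "K \<le> m" "K \<le> n" for K
    using B.small_point_bound[OF P' that] cardE' by simp
  \<comment> \<open>If the other coordinate is 1, the sharper bound applies; otherwise that
    coordinate absorbs at least 2.\<close>
  have d_le: "d1 \<le> 3 * int (card E) + 2" "d2 \<le> 3 * int (card E) + 2"
    using size d neq by linarith+
  consider "card E = 0" | "card E = 1" | "2 \<le> card E" by linarith
  then show False
  proof cases
    case 1
    then have E: "E = {}" "E' = {}" using cardE' A.finite_gaps B.finite_gaps by auto
    have d3: "d1 = 2" "d2 = 1"
      using d_le lt d 1 by simp_all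
    have "\<bar>z\<bar> \<le> 1 \<Longrightarrow> z \<in> {0, d1 - d2, 2 * (d1 - d2)}" for z
      using small[of z] E d3 K 1 by auto
    from this[of "-1"] show False using d3 by auto
  next
    case 2
    then obtain g where g: "E = {g}" by (rule card_1_singletonE)
    from 2 cardE' obtain g' where g': "E' = {g'}" by (metis card_1_singletonE)
    have K8: "8 \<le> m" "8 \<le> n" using K 2 by simp_all
    have ex: "d1 - d2 = u \<and> g' = g \<or> d1 - d2 \<noteq> u \<and> d1 - d2 = g \<and> (g' = u \<or> g' = w)"
      using exchange g g' unfolding u_def w_def by auto
    have I: "z \<in> {0, u, w, 2 * u, g} \<or> z - u = g \<or> w - z = g \<or> 2 * z = w" if "u - d2 < z" "z < u + d1" for z
      using near[OF that] g by auto
    have J: "z \<in> {0, d1 - d2, 2 * (d1 - d2), g'} \<or> z + (d1 - d2) = g' \<or> z - (d1 - d2) = g'"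
      if "d1 \<le> 4" "\<bar>z\<bar> \<le> 8 - d1 - d2" for z
      using small[of z] that lt g' K8 by auto
    \<comment> \<open>\<open>count\<close> needs \<open>2 * d1 \<le> m\<close>, which
      \<open>8 \<le> m\<close> guarantees only up to \<open>d1 = 4\<close>.\<close>
    have "d1 + d2 \<ge> 6"
    proof (cases "d1 \<le> 4")
      case True
      then show ?thesis using count[of 8] K8 lt 2 by simp
    next
      case False
      then show ?thesis using d by simp
    qed
    moreover have "d1 \<le> 5" "d1 + d2 \<le> 7" using d_le size(1) 2 by simp_all
    ultimately have sizes: "d1 = 4 \<and> d2 = 2 \<or> d1 = 4 \<and> d2 = 3 \<or> d1 = 5 \<and> d2 = 1 \<or> d1 = 5 \<and> d2 = 2"
      using lt d by linarith
    have "d1 = 5 \<and> d2 = 2 \<and> u = -1 \<and> w = 2 \<and> g = 3"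
      by (rule single_gap_configuration[OF sizes _ _ ex w_def u0]) (fact I J)+
    then have d': "d1 = 5" "d2 = 2" and uwg: "u = -1" "w = 2" "g = 3" by auto
    have g'v: "g' = -1 \<or> g' = 2" using ex d' uwg by auto
    have a: "a2 = a1 + 1" using uwg(1) u_def by simp
    \<comment> \<open>The differences of this point with \<open>(d1, d2)\<close> and the two ends of
      the jump have offsets 1, 5 and -2. None is a gap of the transversal concerned, which pins down
      \<open>a1\<close>.\<close>
    obtain i j where ij: "(i, j) \<in> P" "i = j + 4"
      using A.cover[of 4] g uwg K8 by (auto simp: algebra_simps)
    have "(i, j) \<in> P'" using rest ij a d' by auto
    then have "j \<le> 2" using B.diff_gap[OF P', of i j] ij(2) d' g' g'v by - (rule ccontr, auto)
    moreover have "j \<le> a1 + 1" using A.diff_gap[OF P(1) ij(1)] ij(2) a g uwg by - (rule ccontr, auto)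
    moreover have "a1 + 1 \<le> j" using A.diff_gap[OF ij(1) P(2)] ij(2) a d' g uwg by - (rule ccontr, auto)
    ultimately have a1: "a1 = 1" using A.in_grid[OF P(1)] by linarith
    \<comment> \<open>The jump now leads from \<open>(1, 2)\<close> to \<open>(6, 4)\<close>. The
      difference with its upper end has offset -1 and keeps this point low; the sum with its lower
      end has offset 0 and must leave the grid.\<close>
    obtain k l where kl: "(k, l) \<in> P" "k = l + 1"
      using A.cover[of 1] g uwg K8 by (auto simp: algebra_simps)
    have "l \<le> 5" using A.diff_gap[OF P(2) kl(1)] kl(2) a a1 d' g uwg by - (rule ccontr, auto)
    moreover have "\<not> (l + 1 + a1 \<le> m \<and> l + a2 \<le> n)"
      using A.sum_gap[OF kl(1) P(1)] kl(2) a a1 g uwg by auto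
    ultimately show False using a a1 K8 by linarith
  next
    case 3
    note pow = two_power_ge[OF 3]
    \<comment> \<open>For \<open>D = card E\<close> at least 2, \<open>4 * 2 ^ D\<close> is at least
      \<open>16 * D - 16\<close>, hence at least twice \<open>3 * D + 2\<close>.\<close>
    have "2 * d1 \<le> m" "2 * d2 \<le> n"
      using pow d_le K 3 by linarith+
    then have "2 * (4 * 2 ^ card E - d1 - d2) + 1 \<le> 3 * int (card E) + 3"
      by (rule count) (use K in auto)
    moreover have "2 \<le> int (card E)" using 3 by simp
    ultimately show False using pow size(1) by (simp add: algebra_simps)
  qed
qed

text \<open>Transposition negates offsets; this reduces the case \<open>d1 < d2\<close> to
  \<open>d2 < d1\<close>.\<close>

lemma sparse_transversal_swap:
  assumes "sparse_transversal m n P E"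
  shows "sparse_transversal n m (prod.swap ` P) (uminus ` E)"
proof -
  interpret sparse_transversal m n P E by fact
  have mem: "(x, y) \<in> prod.swap ` P \<longleftrightarrow> (y, x) \<in> P" for x y by force
  have neg: "z \<in> uminus ` E \<longleftrightarrow> - z \<in> E" for z by force
  show ?thesis
  proof
    show "1 \<le> x \<and> x \<le> n \<and> 1 \<le> y \<and> y \<le> m \<and> x \<noteq> y" if "(x, y) \<in> prod.swap ` P" for x y
      using in_grid[of y x] that mem by auto
    show "finite (uminus ` E)" using finite_gaps by simp
    show "z \<in> uminus ` E \<or> (\<exists>x y. (x, y) \<in> prod.swap ` P \<and> x - y = z)"
      if "1 - m \<le> z" "z \<le> n - 1" "z \<noteq> 0" for z
      using cover[of "- z"] that unfolding mem neg by force
    show "(x - y) + (x' - y') \<in> uminus ` E"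
      if "(x, y) \<in> prod.swap ` P" "(x', y') \<in> prod.swap ` P" "(x, y) \<noteq> (x', y')" "x + x' \<le> n" "y + y' \<le> m"
      for x y x' y'
      using sum_gap[of y x y' x'] that unfolding mem neg by (auto simp: algebra_simps)
    show "(x' - y') - (x - y) \<in> uminus ` E \<or> x' - y' = 2 * (x - y)"
      if "(x, y) \<in> prod.swap ` P" "(x', y') \<in> prod.swap ` P" "x < x'" "y < y'"
      for x y x' y'
      using diff_gap[of y x y' x'] that unfolding mem neg by (auto simp: algebra_simps)
  qed
qed

lemma sparse_transversal_no_jump:
  assumes sp: "sparse_transversal m n P E" and sp': "sparse_transversal m n P' E'"
    and P: "(a1, a2) \<in> P" "(a1 + d1, a2 + d2) \<in> P" and d: "1 \<le> d1" "1 \<le> d2"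
    and P': "(d1, d2) \<in> P'"
    and K: "4 * 2 ^ card E \<le> m" "4 * 2 ^ card E \<le> n"
    and cardE': "card E' = card E"
    and exchange: "d1 - d2 = a1 - a2 \<and> E' = E \<or>
      d1 - d2 \<noteq> a1 - a2 \<and> d1 - d2 \<in> E \<and> (E' = insert (a1 - a2) (E - {d1 - d2}) \<or>
        E' = insert (a1 - a2 + d1 - d2) (E - {d1 - d2}))"
    and rest: "P - {(a1, a2), (a1 + d1, a2 + d2)} \<subseteq> P'"
  shows False
proof -
  have "d1 \<noteq> d2" using sparse_transversal.in_grid[OF sp' P'] by simp
  then consider "d2 < d1" | "d1 < d2" by linarith
  then show False
  proof cases
    case 1
    then show False using sparse_transversal_no_jump_aux assms by blast
  next
    case 2
    have cards: "card (uminus ` E) = card E" "card (uminus ` E') = card E'"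
      by (simp_all add: card_image)
    have ins: "uminus ` insert x (E - {y}) = insert (- x) (uminus ` E - {- y})" for x y :: int
      by (auto simp: image_iff)
    show False
    proof (rule sparse_transversal_no_jump_aux[OF sparse_transversal_swap[OF sp] sparse_transversal_swap[OF sp']])
      show "d2 - d1 = a2 - a1 \<and> uminus ` E' = uminus ` E \<or>
        d2 - d1 \<noteq> a2 - a1 \<and> d2 - d1 \<in> uminus ` E \<and> (uminus ` E' = insert (a2 - a1) (uminus ` E - {d2 - d1}) \<or>
          uminus ` E' = insert (a2 - a1 + d2 - d1) (uminus ` E - {d2 - d1}))"
        using exchange
      proof (elim disjE conjE)
        assume h: "d1 - d2 \<noteq> a1 - a2" "d1 - d2 \<in> E" "E' = insert (a1 - a2) (E - {d1 - d2})"
        have "uminus ` E' = insert (a2 - a1) (uminus ` E - {d2 - d1})"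
          unfolding h(3) ins by simp
        moreover have "d2 - d1 \<in> uminus ` E" by (rule image_eqI[OF _ h(2)]) simp
        ultimately show ?thesis using h(1) by simp
      next
        assume h: "d1 - d2 \<noteq> a1 - a2" "d1 - d2 \<in> E" "E' = insert (a1 - a2 + d1 - d2) (E - {d1 - d2})"
        have eq: "- (a1 - a2 + d1 - d2) = a2 - a1 + d2 - d1" by simp
        have "uminus ` E' = insert (a2 - a1 + d2 - d1) (uminus ` E - {d2 - d1})"
          unfolding h(3) ins unfolding eq unfolding minus_diff_eq by (rule refl)
        moreover have "d2 - d1 \<in> uminus ` E" by (rule image_eqI[OF _ h(2)]) simp
        ultimately show ?thesis using h(1) by simp
      qed auto
      have mem: "(y, x) \<in> prod.swap ` Q \<longleftrightarrow> (x, y) \<in> Q" for x y and Q :: "(int \<times> int) set"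
        by force
      show "(a2, a1) \<in> prod.swap ` P" "(a2 + d2, a1 + d1) \<in> prod.swap ` P" "(d2, d1) \<in> prod.swap ` P'"
        using P P' mem by auto
      show "prod.swap ` P - {(a2, a1), (a2 + d2, a1 + d1)} \<subseteq> prod.swap ` P'"
        using rest mem by auto
    qed (use d K cardE' 2 cards in simp_all)
  qed
qed

section \<open>Sparse transversals from rainbow-free colorings\<close>

text \<open>The diagonal of index \<open>k\<close> consists of the points of offset \<open>m - k\<close>.\<close>

definition offset :: "int \<times> int \<Rightarrow> int" where
  "offset x = fst x - snd x"

locale rainbow_free_coloring =
  fixes m n :: nat and c :: "int \<times> int \<Rightarrow> nat"
  assumes m_pos: "1 \<le> m" and mn: "m \<le> n"
    and exact: "exact_coloring m n (m + n + 1) c"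
    and no_rainbow: "\<nexists>x1 x2 x3. rainbow_solution m n c x1 x2 x3"
begin

definition main_colors :: "nat set" where
  "main_colors = c ` diagonal m n (int m)"

definition transversal :: "(int \<times> int) set \<Rightarrow> bool" where
  "transversal P \<longleftrightarrow> P \<subseteq> grid m n \<and> inj_on c P \<and> c ` P = c ` grid m n - main_colors"

text \<open>The interval consists of the offsets occurring in the grid, from \<open>(1, n)\<close>
  to \<open>(m, 1)\<close>.\<close>

definition gaps :: "(int \<times> int) set \<Rightarrow> int set" where
  "gaps P = {1 - int n..int m - 1} - {0} - offset ` P"

lemma two_colors:
  assumes "x \<in> grid m n" "y \<in> grid m n" "x + y \<in> grid m n"
  shows "c x = c y \<or> c x = c (x + y) \<or> c y = c (x + y)"
  using no_rainbow assms unfolding rainbow_solution_def by blast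

lemma offset_zero_main_color:
  assumes "x \<in> grid m n" "offset x = 0"
  shows "c x \<in> main_colors"
  using assms unfolding main_colors_def diagonal_def offset_def by (cases x) auto

text \<open>Two points of a diagonal differ by a point of the main diagonal, whose color is not
  new.\<close>

lemma same_offset_same_color:
  assumes "x \<in> grid m n" "y \<in> grid m n" "offset x = offset y" "c x \<notin> main_colors" "c y \<notin> main_colors"
  shows "c x = c y"
proof -
  have less: "c x = c y"
    if xy: "x \<in> grid m n" "y \<in> grid m n" "offset x = offset y" "fst x < fst y"
      and new: "c x \<notin> main_colors" "c y \<notin> main_colors" for x y
  proof -
    have "y - x \<in> grid m n" "offset (y - x) = 0"
      using xy unfolding grid_def offset_def by (cases x; cases y; simp)+
    then have "c (y - x) \<in> main_colors" by (rule offset_zero_main_color)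
    moreover have "x + (y - x) = y" by simp
    ultimately show ?thesis
      using two_colors[OF xy(1) \<open>y - x \<in> grid m n\<close>] xy(2) new by auto
  qed
  consider "fst x < fst y" | "fst y < fst x" | "x = y"
    using assms(3) unfolding offset_def by (cases x; cases y) force
  then show ?thesis
    using less[of x y] less[of y x] assms by cases auto
qed

text \<open>As \<open>m \<le> n\<close>, the main diagonal runs from \<open>(1, 1)\<close> to
  \<open>(m, m)\<close> and is colored like an interval.\<close>

lemma main_colors_bound: "2 ^ (card main_colors - 1) \<le> m"
proof -
  define f where "f s = c (int s, int s)" for s
  have "main_colors = f ` {1..m}"
  proof (intro equalityI subsetI)
    fix e assume "e \<in> main_colors"
    then obtain i where "1 \<le> i" "i \<le> int m" "e = c (i, i)"
      unfolding main_colors_def diagonal_def grid_def by auto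
    then show "e \<in> f ` {1..m}" unfolding f_def by (intro image_eqI[of _ _ "nat i"]) auto
  next
    fix e assume "e \<in> f ` {1..m}"
    then show "e \<in> main_colors"
      using mn unfolding main_colors_def diagonal_def grid_def f_def by auto
  qed
  moreover have "2 ^ (card (f ` {1..m}) - 1) \<le> m"
  proof (rule card_colors_rainbow_free_interval[OF m_pos])
    fix x y :: nat assume "1 \<le> x" "1 \<le> y" "x + y \<le> m"
    then show "f x = f y \<or> f x = f (x + y) \<or> f y = f (x + y)"
      using two_colors[of "(int x, int x)" "(int y, int y)"] mn unfolding grid_def f_def by auto
  qed
  ultimately show ?thesis by simp
qed

lemma transversal_offset:
  assumes P: "transversal P" and "x \<in> P"
  shows "x \<in> grid m n" "c x \<notin> main_colors" "offset x \<noteq> 0" "1 - int n \<le> offset x" "offset x \<le> int m - 1"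
proof -
  show "x \<in> grid m n" "c x \<notin> main_colors" using assms unfolding transversal_def by auto
  then show "offset x \<noteq> 0" "1 - int n \<le> offset x" "offset x \<le> int m - 1"
    using offset_zero_main_color[of x] unfolding grid_def offset_def by auto
qed

lemma transversal_eqI:
  assumes P: "transversal P" and y: "y \<in> P" and x: "x \<in> grid m n" "c x \<notin> main_colors" "offset x = offset y"
  shows "c x = c y"
  using same_offset_same_color[OF x(1) _ x(3) x(2)] transversal_offset[OF P y] by blast

lemma inj_on_offset:
  assumes "transversal P"
  shows "inj_on offset P"
proof (rule inj_onI)
  fix x y assume "x \<in> P" "y \<in> P" "offset x = offset y"
  then have "c x = c y" using transversal_eqI transversal_offset assms by blast
  then show "x = y" using assms \<open>x \<in> P\<close> \<open>y \<in> P\<close> unfolding transversal_def inj_on_def by blast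
qed

text \<open>Of \<open>m + n - 2\<close> nonzero offsets, the chosen points occupy one for each of
  the \<open>m + n + 1 - card main_colors\<close> new colors.\<close>

lemma card_gaps:
  assumes P: "transversal P"
  shows "card (gaps P) + 3 = card main_colors"
proof -
  have colors: "c ` grid m n = {1..m + n + 1}" using exact unfolding exact_coloring_def by simp
  have sub: "main_colors \<subseteq> {1..m + n + 1}"
    unfolding colors[symmetric] main_colors_def diagonal_def by auto
  have "card P = card (c ` P)" 
    by (rule card_image[symmetric]) (use P in \<open>simp add: transversal_def\<close>)
  also have "\<dots> = card ({1..m + n + 1} - main_colors)" using P colors unfolding transversal_def by simp
  also have "\<dots> = (m + n + 1) - card main_colors"
    using sub by (subst card_Diff_subset) (auto intro: finite_subset)
  finally have cP: "card (offset ` P) = (m + n + 1) - card main_colors"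
    using card_image[OF inj_on_offset[OF P]] by simp
  have "card main_colors \<le> m + n + 1" using card_mono[OF _ sub] by simp
  moreover have off: "offset ` P \<subseteq> {1 - int n..int m - 1} - {0}" using transversal_offset[OF P] by auto
  moreover have "card ({1 - int n..int m - 1} - {0}) = m + n - 2"
    using m_pos mn by (subst card_Diff_subset) auto
  moreover have "card (gaps P) = card ({1 - int n..int m - 1} - {0}) - card (offset ` P)"
    unfolding gaps_def using off by (intro card_Diff_subset) (auto intro: finite_subset)
  moreover have "card (offset ` P) \<le> card ({1 - int n..int m - 1} - {0})"
    using off by (intro card_mono) auto
  ultimately show ?thesis using cP m_pos mn by linarith
qed

text \<open>Sums and differences repeat the color of one of the two points. Since chosen offsets are
  nonzero, a sum cannot share a diagonal with either point, and a difference only in the doubling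
  case.\<close>

lemma sparse_transversal_gaps:
  assumes P: "transversal P"
  shows "sparse_transversal (int m) (int n) P (gaps P)"
proof -
  \<comment> \<open>A third chosen point on the diagonal of \<open>x\<close> would have the color of
    \<open>x\<close>, hence of \<open>y\<close> or \<open>y'\<close>.\<close>
  have gapI: "z = offset y \<or> z = offset y' \<or> z \<in> gaps P"
    if y: "y \<in> P" "y' \<in> P" and x: "x \<in> grid m n" "offset x = z" "c x = c y \<or> c x = c y'" for x y y' z
  proof (cases "z \<in> offset ` P")
    case True
    then obtain q where q: "q \<in> P" "offset q = z" by auto
    have new: "c x \<notin> main_colors" using x(3) transversal_offset(2)[OF P y(1)] transversal_offset(2)[OF P y(2)] by auto
    then have "c x = c q" using transversal_eqI[OF P q(1) x(1)] q x by simp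
    then have "q = y \<or> q = y'" using x(3) q(1) y P unfolding transversal_def inj_on_def by metis
    then show ?thesis using q by auto
  next
    case False
    have new: "c x \<notin> main_colors" using x(3) transversal_offset(2)[OF P y(1)] transversal_offset(2)[OF P y(2)] by auto
    then have "z \<noteq> 0" using offset_zero_main_color[OF x(1)] x(2) by auto
    then show ?thesis using False x(1,2) unfolding gaps_def grid_def offset_def by auto
  qed
  have neq: "c p \<noteq> c q" if "p \<in> P" "q \<in> P" "p \<noteq> q" for p q
    using that P unfolding transversal_def inj_on_def by blast
  show ?thesis
  proof
    show "1 \<le> x \<and> x \<le> int m \<and> 1 \<le> y \<and> y \<le> int n \<and> x \<noteq> y" if "(x, y) \<in> P" for x y
      using transversal_offset[OF P that] unfolding grid_def offset_def by auto
    show "finite (gaps P)" unfolding gaps_def by simp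
    show "z \<in> gaps P \<or> (\<exists>x y. (x, y) \<in> P \<and> x - y = z)"
      if "1 - int n \<le> z" "z \<le> int m - 1" "z \<noteq> 0" for z
      using that unfolding gaps_def offset_def by force
    show "(x - y) + (x' - y') \<in> gaps P"
      if h: "(x, y) \<in> P" "(x', y') \<in> P" "(x, y) \<noteq> (x', y')" "x + x' \<le> int m" "y + y' \<le> int n" for x y x' y'
    proof -
      note g = transversal_offset[OF P h(1)] transversal_offset[OF P h(2)]
      have s: "(x + x', y + y') \<in> grid m n" using g(1,6) h(4,5) unfolding grid_def by auto
      then have "c (x + x', y + y') = c (x, y) \<or> c (x + x', y + y') = c (x', y')"
        using two_colors[OF g(1,6)] neq[OF h(1-3)] by auto
      from gapI[OF h(1,2) s refl this] show ?thesis
        using g(3,8) unfolding offset_def by (auto simp: algebra_simps)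
    qed
    show "(x' - y') - (x - y) \<in> gaps P \<or> x' - y' = 2 * (x - y)"
      if h: "(x, y) \<in> P" "(x', y') \<in> P" "x < x'" "y < y'" for x y x' y'
    proof -
      note g = transversal_offset[OF P h(1)] transversal_offset[OF P h(2)]
      have s: "(x' - x, y' - y) \<in> grid m n" using g(1,6) h(3,4) unfolding grid_def by auto
      have "c (x, y) \<noteq> c (x', y')" using neq[OF h(1,2)] h(3) by auto
      then have "c (x' - x, y' - y) = c (x, y) \<or> c (x' - x, y' - y) = c (x', y')"
        using two_colors[OF g(1) s] g(6) by auto
      from gapI[OF h(1,2) s refl this] show ?thesis
        using g(3) unfolding offset_def by (auto simp: algebra_simps)
    qed
  qed
qed

lemma ex_transversal:
  assumes "x \<in> grid m n" "y \<in> grid m n" "c x \<notin> main_colors" "c y \<notin> main_colors" "c x \<noteq> c y"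
  shows "\<exists>P. transversal P \<and> x \<in> P \<and> y \<in> P"
proof -
  define N where "N = c ` grid m n - main_colors"
  have "\<forall>e \<in> N. \<exists>z. z \<in> grid m n \<and> c z = e" unfolding N_def by auto
  then obtain g where g: "\<And>e. e \<in> N \<Longrightarrow> g e \<in> grid m n \<and> c (g e) = e" by metis
  define h where "h = g(c x := x, c y := y)"
  have h: "h e \<in> grid m n \<and> c (h e) = e" if "e \<in> N" for e
    using g[OF that] assms unfolding h_def by auto
  have "transversal (h ` N)"
    unfolding transversal_def N_def[symmetric] using h by (force simp: inj_on_def image_iff)
  moreover have "h (c x) = x" "h (c y) = y" "c x \<in> N" "c y \<in> N"
    using assms unfolding h_def N_def by auto
  ultimately show ?thesis by (metis imageI)
qed

text \<open>A chosen point on the diagonal of \<open>x\<close> would share the color of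
  \<open>x\<close> and so be \<open>q\<close>. Hence moving from \<open>q\<close> to another
  diagonal closes one gap and opens one at \<open>offset q\<close>.\<close>

lemma transversal_exchange:
  assumes P: "transversal P" and q: "q \<in> P" and x: "x \<in> grid m n" "c x = c q"
  shows "transversal (insert x (P - {q}))"
    and "offset x = offset q \<Longrightarrow> gaps (insert x (P - {q})) = gaps P"
    and "offset x \<noteq> offset q \<Longrightarrow> offset x \<in> gaps P"
    and "offset x \<noteq> offset q \<Longrightarrow> gaps (insert x (P - {q})) = insert (offset q) (gaps P - {offset x})"
proof -
  have inj: "inj_on c P" using P unfolding transversal_def by simp
  have new: "c x \<notin> main_colors" using x q transversal_offset(2)[OF P] by simp
  have "c ` insert x (P - {q}) = c ` P" using q x(2) by (auto simp: image_iff)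
  moreover have "inj_on c (insert x (P - {q}))"
    using inj q x(2) by (auto simp: inj_on_def)
  ultimately show "transversal (insert x (P - {q}))"
    using P x(1) unfolding transversal_def by auto
  have off: "offset ` (P - {q}) = offset ` P - {offset q}"
    using inj_on_image_set_diff[OF inj_on_offset[OF P], of P "{q}"] q by simp
  have offq: "offset q \<in> offset ` P" using q by simp
  show "gaps (insert x (P - {q})) = gaps P" if "offset x = offset q"
    using that offq unfolding gaps_def image_insert off by auto
  show mem: "offset x \<in> gaps P" if "offset x \<noteq> offset q"
  proof -
    have "offset x \<notin> offset ` P"
    proof
      assume "offset x \<in> offset ` P"
      then obtain y where y: "y \<in> P" "offset x = offset y" by auto
      then have "c y = c q" using transversal_eqI[OF P y(1) x(1) new] x(2) by simp
      then show False using inj y q that unfolding inj_on_def by blast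
    qed
    moreover have "offset x \<noteq> 0" using offset_zero_main_color[OF x(1)] new by auto
    ultimately show ?thesis using x(1) unfolding gaps_def grid_def offset_def by auto
  qed
  show "gaps (insert x (P - {q})) = insert (offset q) (gaps P - {offset x})" if "offset x \<noteq> offset q"
    using that offq transversal_offset[OF P q] unfolding gaps_def image_insert off by auto
qed

lemma jump_colors:
  assumes grid: "\<alpha> \<in> grid m n" "\<delta> \<in> grid m n" "\<alpha> + \<delta> \<in> grid m n"
    and new: "c \<alpha> \<notin> main_colors" "c (\<alpha> + \<delta>) \<notin> main_colors"
  shows "c \<alpha> = c (\<alpha> + \<delta>)"
proof (rule ccontr)
  assume neq: "c \<alpha> \<noteq> c (\<alpha> + \<delta>)"
  obtain P where P: "transversal P" "\<alpha> \<in> P" "\<alpha> + \<delta> \<in> P"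
    using ex_transversal[OF grid(1,3) new neq] by blast
  have "c \<delta> = c \<alpha> \<or> c \<delta> = c (\<alpha> + \<delta>)" using two_colors[OF grid] neq by auto
  then obtain q where q: "q \<in> {\<alpha>, \<alpha> + \<delta>}" "c \<delta> = c q" by blast
  have qP: "q \<in> P" using q P by auto
  let ?Q = "insert \<delta> (P - {q})"
  note ex = transversal_exchange[OF P(1) qP grid(2) q(2)]
  have off: "offset (\<alpha> + \<delta>) = offset \<alpha> + offset \<delta>" unfolding offset_def by simp
  have \<alpha>0: "offset \<alpha> \<noteq> 0" using transversal_offset(3)[OF P(1,2)] .
  have exchange: "offset \<delta> = offset \<alpha> \<and> gaps ?Q = gaps P \<or>
    offset \<delta> \<noteq> offset \<alpha> \<and> offset \<delta> \<in> gaps P \<and> (gaps ?Q = insert (offset \<alpha>) (gaps P - {offset \<delta>}) \<or>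
      gaps ?Q = insert (offset \<alpha> + offset \<delta>) (gaps P - {offset \<delta>}))"
  proof (cases "offset \<delta> = offset q")
    case True
    \<comment> \<open>The offsets of \<open>\<alpha> + \<delta>\<close> and \<open>\<delta>\<close>
      differ by the nonzero offset of \<open>\<alpha>\<close>.\<close>
    then have "q = \<alpha>" using q(1) off \<alpha>0 by auto
    then show ?thesis using True ex(2) by auto
  next
    case False
    have "offset \<alpha> \<notin> gaps P" using P(2) unfolding gaps_def by auto
    then have "offset \<delta> \<noteq> offset \<alpha>" using ex(3)[OF False] by metis
    moreover have "offset q = offset \<alpha> \<or> offset q = offset \<alpha> + offset \<delta>" using q(1) off by auto
    ultimately show ?thesis using ex(3)[OF False] ex(4)[OF False] by metis
  qed
  \<comment> \<open>The surplus 3 in \<open>card_gaps\<close> yields the factor 4 in the size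
    bound.\<close>
  have "card main_colors - 1 = card (gaps P) + 2" using card_gaps[OF P(1)] by simp
  then have "4 * 2 ^ card (gaps P) = (2::nat) ^ (card main_colors - 1)"
    by (simp add: power_add)
  then have "4 * 2 ^ card (gaps P) \<le> m" using main_colors_bound by simp
  then have "int (4 * 2 ^ card (gaps P)) \<le> int m" by (simp only: of_nat_le_iff)
  then have K: "4 * 2 ^ card (gaps P) \<le> int m" "4 * 2 ^ card (gaps P) \<le> int n"
    using mn by simp_all
  obtain a1 a2 d1 d2 where ad: "\<alpha> = (a1, a2)" "\<delta> = (d1, d2)" by (cases \<alpha>; cases \<delta>)
  show False
  proof (rule sparse_transversal_no_jump[OF sparse_transversal_gaps[OF P(1)] sparse_transversal_gaps[OF ex(1)]])
    show "(a1, a2) \<in> P" "(a1 + d1, a2 + d2) \<in> P" "(d1, d2) \<in> ?Q" using P ad by auto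
    show "1 \<le> d1" "1 \<le> d2" using grid(2) ad unfolding grid_def by auto
    show "card (gaps ?Q) = card (gaps P)"
      using card_gaps[OF P(1)] card_gaps[OF ex(1)] by simp
    have offs: "offset \<alpha> = a1 - a2" "offset \<delta> = d1 - d2" "offset \<alpha> + offset \<delta> = a1 - a2 + d1 - d2"
      unfolding offset_def ad by simp_all
    show "d1 - d2 = a1 - a2 \<and> gaps ?Q = gaps P \<or>
      d1 - d2 \<noteq> a1 - a2 \<and> d1 - d2 \<in> gaps P \<and> (gaps ?Q = insert (a1 - a2) (gaps P - {d1 - d2}) \<or>
        gaps ?Q = insert (a1 - a2 + d1 - d2) (gaps P - {d1 - d2}))"
      using exchange unfolding offs(3) unfolding offs(1,2) .
    show "P - {(a1, a2), (a1 + d1, a2 + d2)} \<subseteq> ?Q" using q(1) ad by auto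
  qed (use K in auto)
qed

end

theorem theorem4p9:
  fixes m n :: nat and c :: "int \<times> int \<Rightarrow> nat"
    and a b t :: int and \<alpha> \<beta> \<delta> :: "int \<times> int"
  assumes "3 \<le> m" and "m \<le> n"
    and "exact_coloring m n (m + n + 1) c"
    and "\<nexists>x1 x2 x3. rainbow_solution m n c x1 x2 x3"
    and "jump m n a \<alpha> b \<beta>"
    and "\<delta> \<in> diagonal m n t" and "\<alpha> + \<delta> = \<beta>"
  shows "c \<alpha> \<in> c ` diagonal m n (int m) \<or> c \<beta> \<in> c ` diagonal m n (int m) \<or> c \<alpha> = c \<beta>"
proof -
  interpret rainbow_free_coloring m n c
    by unfold_locales (use assms(1-4) in auto)
  have "\<alpha> \<in> grid m n" "\<beta> \<in> grid m n" "\<delta> \<in> grid m n"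
    using assms(5,6) unfolding jump_def diagonal_def by auto
  then show ?thesis
    using jump_colors[of \<alpha> \<delta>] assms(7) unfolding main_colors_def by auto
qed

end
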